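(* Let $m,n\ge 1$ be integers, and fix variances $\sigma_1^2,\dots,\sigma_m^2>0$ and visible biases $\mathbf{b}=(b_1,\dots,b_m)\in\mathbb{R}^m$. For $\mathbf{w}=(w_{ij})\in\mathbb{R}^{m\times n}$, $\mathbf{c}=(c_1,\dots,c_n)\in\mathbb{R}^n$, $\mathbf{v}\in\mathbb{R}^m$ and $\mathbf{h}\in\{0,1\}^n$ let $$E(\mathbf{v},\mathbf{h};\mathbf{w},\mathbf{c})=\sum_{i=1}^m\frac{(v_i-b_i)^2}{2\sigma_i^2}-\sum_{i=1}^m\sum_{j=1}^n\frac{w_{ij}v_ih_j}{\sigma_i^2}-\sum_{j=1}^n c_jh_j,$$ and define $$g(\mathbf{w},\mathbf{c};\mathbf{v})=\log\sum_{\mathbf{h}\in\{0,1\}^n}e^{-E(\mathbf{v},\mathbf{h};\mathbf{w},\mathbf{c})},\qquad f(\mathbf{w},\mathbf{c})=\log\sum_{\mathbf{h}\in\{0,1\}^n}\int_{\mathbb{R}^m}e^{-E(\mathbf{v}',\mathbf{h};\mathbf{w},\mathbf{c})}\,d\mathbf{v}'.$$ Then for every $\mathbf{v}\in\mathbb{R}^m$ both $(\mathbf{w},\mathbf{c})\mapsto g(\mathbf{w},\mathbf{c};\mathbf{v})$ and $(\mathbf{w},\mathbf{c})\mapsto f(\mathbf{w},\mathbf{c})$ are convex functions on $\mathbb{R}^{m\times n}\times\mathbb{R}^n$. Consequently the log-likelihood of a training sample $\mathbf{v}$ under the Gaussian-Bernoulli restricted Boltzmann machine, $$\mathcal{L}(\mathbf{w},\mathbf{c}\mid\mathbf{v})=\log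 p(\mathbf{v}\mid\mathbf{w},\mathbf{c})=g(\mathbf{w},\mathbf{c};\mathbf{v})-f(\mathbf{w},\mathbf{c}),$$ is, as a function of $(\mathbf{w},\mathbf{c})$, a difference of two convex functions.
   Context: A Gaussian-Bernoulli restricted Boltzmann machine (GB-RBM) with $m$ real-valued visible units $\mathbf{v}\in\mathbb{R}^m$ and $n$ binary hidden units $\mathbf{h}\in\{0,1\}^n$ has weights $\mathbf{w}$, visible biases $\mathbf{b}$, hidden biases $\mathbf{c}$ and visible variances $\sigma_i^2$. It is the joint distribution with density (with respect to Lebesgue measure on $\mathbb{R}^m$ times counting measure on $\{0,1\}^n$) $p(\mathbf{v},\mathbf{h}\mid\mathbf{w},\mathbf{c})=e^{-E(\mathbf{v},\mathbf{h};\mathbf{w},\mathbf{c})}/Z(\mathbf{w},\mathbf{c})$, where $Z(\mathbf{w},\mathbf{c})=\sum_{\mathbf{h}\in\{0,1\}^n}\int_{\mathbb{R}^m}e^{-E(\mathbf{v},\mathbf{h};\mathbf{w},\mathbf{c})}\,d\mathbf{v}$ is the partition function. The marginal density of the visible units is $p(\mathbf{v}\mid\mathbf{w},\mathbf{c})=\sum_{\mathbf{h}\in\{0,1\}^n}p(\mathbf{v},\mathbf{h}\mid\mathbf{w},\mathbf{c})$. The quantities $\mathbf{b}$ and $\sigma_i^2$ are held constant; only $\mathbf{w}$ and $\mathbf{c}$ vary. *)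

theory Defs
  imports "HOL-Analysis.Analysis"
begin

text \<open>
  The index types \<open>'m\<close> and \<open>'n\<close> number the visible and the hidden units.  The parameter
  \<open>\<sigma>\<close> is the vector of the \<open>\<sigma>\<^sub>i\<close>, so that the variances are the squares \<open>(\<sigma> $ i)\<^sup>2\<close>; the
  matrix entry \<open>w\<^sub>i\<^sub>j\<close> is \<open>w $ i $ j\<close>.
\<close>

definition hidden_states :: "(real ^ 'n) set" where
  "hidden_states = {h. \<forall>j. h $ j \<in> {0, 1}}"

definition energy ::
  "real ^ 'm \<Rightarrow> real ^ 'm \<Rightarrow> real ^ 'm \<Rightarrow> real ^ 'n \<Rightarrow> real ^ 'n ^ 'm \<Rightarrow> real ^ 'n \<Rightarrow> real" where
  "energy \<sigma> b v h w c =
     (\<Sum>i\<in>UNIV. (v $ i - b $ i)\<^sup>2 / (2 * (\<sigma> $ i)\<^sup>2))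
     - (\<Sum>i\<in>UNIV. \<Sum>j\<in>UNIV. w $ i $ j * v $ i * h $ j / (\<sigma> $ i)\<^sup>2)
     - (\<Sum>j\<in>UNIV. c $ j * h $ j)"

definition partition_function ::
  "real ^ 'm \<Rightarrow> real ^ 'm \<Rightarrow> real ^ 'n ^ 'm \<Rightarrow> real ^ 'n \<Rightarrow> real" where
  "partition_function \<sigma> b w c =
     (\<Sum>h\<in>hidden_states. LINT v|lborel. exp (- energy \<sigma> b v h w c))"

definition joint_density ::
  "real ^ 'm \<Rightarrow> real ^ 'm \<Rightarrow> real ^ 'm \<Rightarrow> real ^ 'n \<Rightarrow> real ^ 'n ^ 'm \<Rightarrow> real ^ 'n \<Rightarrow> real" where
  "joint_density \<sigma> b v h w c = exp (- energy \<sigma> b v h w c) / partition_function \<sigma> b w c"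

definition marginal_density ::
  "real ^ 'm \<Rightarrow> real ^ 'm \<Rightarrow> real ^ 'm \<Rightarrow> real ^ 'n ^ 'm \<Rightarrow> real ^ 'n \<Rightarrow> real" where
  "marginal_density \<sigma> b v w c = (\<Sum>h\<in>hidden_states. joint_density \<sigma> b v h w c)"

definition log_likelihood ::
  "real ^ 'm \<Rightarrow> real ^ 'm \<Rightarrow> real ^ 'n ^ 'm \<Rightarrow> real ^ 'n \<Rightarrow> real ^ 'm \<Rightarrow> real" where
  "log_likelihood \<sigma> b w c v = ln (marginal_density \<sigma> b v w c)"

definition g_fun ::
  "real ^ 'm \<Rightarrow> real ^ 'm \<Rightarrow> real ^ 'n ^ 'm \<Rightarrow> real ^ 'n \<Rightarrow> real ^ 'm \<Rightarrow> real" where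
  "g_fun \<sigma> b w c v = ln (\<Sum>h\<in>hidden_states. exp (- energy \<sigma> b v h w c))"

definition f_fun ::
  "real ^ 'm \<Rightarrow> real ^ 'm \<Rightarrow> real ^ 'n ^ 'm \<Rightarrow> real ^ 'n \<Rightarrow> real" where
  "f_fun \<sigma> b w c = ln (\<Sum>h\<in>hidden_states. LINT v|lborel. exp (- energy \<sigma> b v h w c))"

definition difference_of_convex :: "('a::real_vector \<Rightarrow> real) \<Rightarrow> bool" where
  "difference_of_convex F \<longleftrightarrow>
     (\<exists>G H. convex_on UNIV G \<and> convex_on UNIV H \<and> (\<forall>x. F x = G x - H x))"

end

theory Submission
  imports Defs "HOL-Probability.Distributions"
begin

text \<open>
  The exponent \<open>- energy\<close> is affine in \<open>(w, c)\<close>, and the logarithm of an integral of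
  exponentials of convex functions is convex: subtracting from the exponents at two points the
  logarithms of their integrals normalises both integrals to \<open>1\<close>, and the convexity of \<open>exp\<close> then
  bounds the integral at an intermediate point.  With Lebesgue measure this gives the convexity of
  the logarithm of each summand of \<open>f\<close>, with counting measure that of the logarithm of the sum.
\<close>

text \<open>A nonnegative function with integral zero vanishes almost everywhere. Since
  \<open>exp\<close> never vanishes, the whole space would be a null set.\<close>

lemma integral_exp_pos:
  fixes f :: "'a \<Rightarrow> real"
  assumes "integrable M (\<lambda>\<omega>. exp (f \<omega>))" and "emeasure M (space M) \<noteq> 0"
  shows "0 < (LINT \<omega>|M. exp (f \<omega>))"
proof -
  have "(LINT \<omega>|M. exp (f \<omega>)) \<noteq> 0"
  proof
    assume "(LINT \<omega>|M. exp (f \<omega>)) = 0"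
    then have "AE \<omega> in M. False"
      using integral_nonneg_eq_0_iff_AE[OF assms(1)] by simp
    then show False
      using assms(2) by (simp add: AE_iff_measurable[OF sets.top])
  qed
  moreover have "0 \<le> (LINT \<omega>|M. exp (f \<omega>))"
    by (simp add: integral_nonneg_AE)
  ultimately show ?thesis
    by linarith
qed

lemma convex_on_ln_integral_exp:
  fixes \<phi> :: "'a::real_vector \<Rightarrow> 'b \<Rightarrow> real"
  assumes "convex S"
    and convex: "\<And>\<omega>. \<omega> \<in> space M \<Longrightarrow> convex_on S (\<lambda>x. \<phi> x \<omega>)"
    and int: "\<And>x. x \<in> S \<Longrightarrow> integrable M (\<lambda>\<omega>. exp (\<phi> x \<omega>))"
    and M: "emeasure M (space M) \<noteq> 0"
  shows "convex_on S (\<lambda>x. ln (LINT \<omega>|M. exp (\<phi> x \<omega>)))"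
proof (rule convex_onI[OF _ \<open>convex S\<close>])
  fix t :: real and x y
  assume t: "0 < t" "t < 1" and xy: "x \<in> S" "y \<in> S"
  define F where "F = (\<lambda>x. LINT \<omega>|M. exp (\<phi> x \<omega>))"
  define z where "z = (1 - t) *\<^sub>R x + t *\<^sub>R y"
  \<comment> \<open>\<open>C\<close> is the bound to be proved for \<open>ln (F z)\<close>. The goal
    thus amounts to \<open>F z / exp C\<close> \<le> 1, and this quotient is the integral of
    \<open>exp (\<phi> z \<omega> - C)\<close>.\<close>
  define C where "C = (1 - t) * ln (F x) + t * ln (F y)"
  have z: "z \<in> S"
    unfolding z_def using \<open>convex S\<close> t xy by (simp add: convex_alt)
  have F_pos: "0 < F u" if "u \<in> S" for u
    unfolding F_def using int[OF that] M by (rule integral_exp_pos)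
  have int': "integrable M (\<lambda>\<omega>. exp (\<phi> u \<omega> - K))" if "u \<in> S" for u K
    using int[OF that] by (simp add: exp_diff)
  have LINT: "(LINT \<omega>|M. exp (\<phi> u \<omega> - K)) = F u / exp K" for u K
    by (simp add: exp_diff F_def)
  have "F z / exp C = (LINT \<omega>|M. exp (\<phi> z \<omega> - C))"
    by (simp add: LINT)
  also have "\<dots> \<le> (LINT \<omega>|M. (1 - t) * exp (\<phi> x \<omega> - ln (F x)) + t * exp (\<phi> y \<omega> - ln (F y)))"
  proof (rule integral_mono)
    fix \<omega> assume "\<omega> \<in> space M"
    then have "\<phi> z \<omega> \<le> (1 - t) * \<phi> x \<omega> + t * \<phi> y \<omega>"
      unfolding z_def using convex_onD[OF convex, of \<omega> t x y] t xy by simp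
    \<comment> \<open>\<open>C\<close> combines \<open>ln (F x)\<close> and \<open>ln (F y)\<close>
      with the same weights \<open>1 - t\<close> and \<open>t\<close>, so each logarithm can be
      absorbed into its own exponent.\<close>
    then have "\<phi> z \<omega> - C \<le> (1 - t) * (\<phi> x \<omega> - ln (F x)) + t * (\<phi> y \<omega> - ln (F y))"
      unfolding C_def by (simp add: algebra_simps)
    then have "exp (\<phi> z \<omega> - C) \<le> exp ((1 - t) * (\<phi> x \<omega> - ln (F x)) + t * (\<phi> y \<omega> - ln (F y)))"
      by simp
    also have "\<dots> \<le> (1 - t) * exp (\<phi> x \<omega> - ln (F x)) + t * exp (\<phi> y \<omega> - ln (F y))"
      using convex_onD[OF exp_convex, of t] t by simp
    finally show "exp (\<phi> z \<omega> - C) \<le> (1 - t) * exp (\<phi> x \<omega> - ln (F x)) + t * exp (\<phi> y \<omega> - ln (F y))" .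
  qed (use int' xy z in auto)
  \<comment> \<open>Both shifted exponentials integrate to 1, and the weights add up to 1.\<close>
  also have "\<dots> = 1"
    using int' xy F_pos[of x] F_pos[of y] by (simp add: LINT)
  finally have "F z \<le> exp C"
    by simp
  then have "ln (F z) \<le> C"
    using F_pos[OF z] by (metis ln_exp ln_mono)
  then show "ln (LINT \<omega>|M. exp (\<phi> ((1 - t) *\<^sub>R x + t *\<^sub>R y) \<omega>))
      \<le> (1 - t) * ln (LINT \<omega>|M. exp (\<phi> x \<omega>)) + t * ln (LINT \<omega>|M. exp (\<phi> y \<omega>))"
    by (simp add: F_def z_def C_def)
qed

text \<open>This is the case of counting measure on \<open>A\<close>: finiteness makes every
  function integrable, nonemptiness makes the total measure nonzero.\<close>

lemma convex_on_ln_sum_exp: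
  fixes \<phi> :: "'a::real_vector \<Rightarrow> 'b \<Rightarrow> real"
  assumes "convex S" "finite A" "A \<noteq> {}"
    and "\<And>a. a \<in> A \<Longrightarrow> convex_on S (\<lambda>x. \<phi> x a)"
  shows "convex_on S (\<lambda>x. ln (\<Sum>a\<in>A. exp (\<phi> x a)))"
  using convex_on_ln_integral_exp[of S "count_space A" \<phi>] assms
  by (simp add: lebesgue_integral_count_space_finite integrable_count_space)

text \<open>Lebesgue measure is the image of a product of one-dimensional Lebesgue measures under
  the map from coordinates to vectors, so integrability of a product of one-variable functions
  follows factor by factor.\<close>

lemma integrable_lborel_prod_Basis:
  fixes f :: "'a::euclidean_space \<Rightarrow> real \<Rightarrow> real"
  assumes int: "\<And>b. b \<in> Basis \<Longrightarrow> integrable lborel (f b)"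
  shows "integrable lborel (\<lambda>x. \<Prod>b\<in>Basis. f b (x \<bullet> b))"
proof -
  interpret product_sigma_finite "\<lambda>b::'a. lborel :: real measure" ..
  have [measurable]: "f b \<in> borel_measurable borel" if "b \<in> Basis" for b
    using borel_measurable_integrable[OF int[OF that]] by simp
  have "integrable (\<Pi>\<^sub>M b\<in>Basis. lborel) (\<lambda>x. \<Prod>b\<in>Basis. f b (x b))"
    by (rule product_integrable_prod) (use int in auto)
  then show ?thesis
    by (subst lborel_eq, subst integrable_distr_eq) simp_all
qed

lemma integrable_lborel_prod_vec:
  fixes f :: "'m::finite \<Rightarrow> real \<Rightarrow> real"
  assumes "\<And>i. integrable lborel (f i)"
  shows "integrable lborel (\<lambda>x :: real ^ 'm. \<Prod>i\<in>UNIV. f i (x $ i))"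
proof -
  let ?e = "\<lambda>i. axis i 1 :: real ^ 'm"
  have e: "inj ?e"
    by (simp add: inj_def axis_eq_axis)
  have Basis: "Basis = range ?e"
    by (auto simp: Basis_vec_def)
  \<comment> \<open>The basis is indexed by vectors; \<open>inv ?e\<close> recovers the coordinate
    index from an axis vector.\<close>
  have "(\<Prod>b\<in>Basis. f (inv ?e b) (x \<bullet> b)) = (\<Prod>i\<in>UNIV. f i (x $ i))" for x
    unfolding Basis prod.reindex[OF e] by (simp add: inv_f_f[OF e] inner_axis)
  then show ?thesis
    using integrable_lborel_prod_Basis[of "\<lambda>b. f (inv ?e b)"] assms by simp
qed

text \<open>Completing the square turns the integrand into a constant multiple of a normal density
  with mean \<open>b + a\<close> and standard deviation \<open>\<bar>s\<bar>\<close>; the absolute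
  value is there because \<open>s\<close> may be negative.\<close>

lemma integrable_exp_quadratic:
  fixes s b a :: real
  assumes "s \<noteq> 0"
  shows "integrable lborel (\<lambda>x. exp (a * x / s\<^sup>2 - (x - b)\<^sup>2 / (2 * s\<^sup>2)))"
proof -
  define K where "K = exp ((a\<^sup>2 + 2 * a * b) / (2 * s\<^sup>2)) * sqrt (2 * pi * s\<^sup>2)"
  have "a * x / s\<^sup>2 - (x - b)\<^sup>2 / (2 * s\<^sup>2)
      = (a\<^sup>2 + 2 * a * b) / (2 * s\<^sup>2) + - (x - (b + a))\<^sup>2 / (2 * s\<^sup>2)" for x
    using assms by (simp add: field_simps power2_eq_square)
  then have "exp (a * x / s\<^sup>2 - (x - b)\<^sup>2 / (2 * s\<^sup>2)) = K * normal_density (b + a) \<bar>s\<bar> x" for x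
    using assms by (simp only: exp_add) (simp add: K_def normal_density_def real_sqrt_mult)
  then show ?thesis
    using assms by (simp add: integrable_normal_density)
qed

text \<open>For fixed \<open>h\<close> the exponent separates over the visible units, with
  \<open>a i\<close> the total input from the hidden units to unit \<open>i\<close>. The exponential
  is then a constant times a product of one-dimensional Gaussian factors.\<close>

lemma integrable_exp_energy:
  fixes \<sigma> b :: "real ^ 'm" and w :: "real ^ 'n ^ 'm" and c h :: "real ^ 'n"
  assumes "\<And>i. \<sigma> $ i \<noteq> 0"
  shows "integrable lborel (\<lambda>v. exp (- energy \<sigma> b v h w c))"
proof -
  define a where "a i = (\<Sum>j\<in>UNIV. w $ i $ j * h $ j)" for i
  have *: "exp (- energy \<sigma> b v h w c) = exp (\<Sum>j\<in>UNIV. c $ j * h $ j) *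
      (\<Prod>i\<in>UNIV. exp (a i * v $ i / (\<sigma> $ i)\<^sup>2 - (v $ i - b $ i)\<^sup>2 / (2 * (\<sigma> $ i)\<^sup>2)))" for v
  proof -
    have "(\<Sum>j\<in>UNIV. w $ i $ j * v $ i * h $ j / (\<sigma> $ i)\<^sup>2) = a i * v $ i / (\<sigma> $ i)\<^sup>2" for i
      unfolding a_def sum_distrib_right sum_divide_distrib by (simp add: mult_ac)
    then show ?thesis
      by (simp add: energy_def flip: exp_sum exp_add) (simp add: sum_subtractf)
  qed
  show ?thesis
    unfolding * by (intro integrable_mult_right integrable_lborel_prod_vec integrable_exp_quadratic assms)
qed

lemma finite_hidden_states: "finite (hidden_states :: (real ^ 'n) set)"
proof (rule finite_subset)
  show "hidden_states \<subseteq> vec_lambda ` (UNIV \<rightarrow>\<^sub>E {0, 1 :: real} :: ('n \<Rightarrow> real) set)"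
  proof
    fix h :: "real ^ 'n"
    assume "h \<in> hidden_states"
    then have "vec_nth h \<in> UNIV \<rightarrow>\<^sub>E {0, 1}"
      by (auto simp: hidden_states_def)
    then show "h \<in> vec_lambda ` (UNIV \<rightarrow>\<^sub>E {0, 1})"
      by (metis imageI vec_nth_inverse)
  qed
qed (simp add: finite_PiE)

lemma hidden_states_nonempty: "hidden_states \<noteq> ({} :: (real ^ 'n) set)"
proof -
  have "(0 :: real ^ 'n) \<in> hidden_states"
    by (simp add: hidden_states_def)
  then show ?thesis
    by blast
qed

lemma convex_on_neg_energy:
  "convex_on UNIV (\<lambda>p :: (real ^ 'n ^ 'm) \<times> (real ^ 'n). - energy \<sigma> b v h (fst p) (snd p))"
proof (rule convex_onI)
  fix t :: real and p q :: "(real ^ 'n ^ 'm) \<times> (real ^ 'n)"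
  define Q where "Q = (\<Sum>i\<in>UNIV. (v $ i - b $ i)\<^sup>2 / (2 * (\<sigma> $ i)\<^sup>2))"
  define L where "L p = (\<Sum>i\<in>UNIV. \<Sum>j\<in>UNIV. fst p $ i $ j * v $ i * h $ j / (\<sigma> $ i)\<^sup>2)
      + (\<Sum>j\<in>UNIV. snd p $ j * h $ j)" for p :: "(real ^ 'n ^ 'm) \<times> (real ^ 'n)"
  have energy: "- energy \<sigma> b v h (fst p) (snd p) = L p - Q" for p
    by (simp add: energy_def L_def Q_def)
  \<comment> \<open>\<open>L\<close> is linear in the parameters and \<open>Q\<close> does not
    depend on them, so the convexity inequality even holds with equality.\<close>
  have "L ((1 - t) *\<^sub>R p + t *\<^sub>R q) = (1 - t) * L p + t * L q"
    by (simp add: L_def distrib_right distrib_left add_divide_distrib sum.distrib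
        sum_distrib_left mult.assoc)
  then show "- energy \<sigma> b v h (fst ((1 - t) *\<^sub>R p + t *\<^sub>R q)) (snd ((1 - t) *\<^sub>R p + t *\<^sub>R q))
      \<le> (1 - t) * - energy \<sigma> b v h (fst p) (snd p) + t * - energy \<sigma> b v h (fst q) (snd q)"
    unfolding energy by (simp add: algebra_simps)
qed simp

lemma convex_on_g_fun:
  "convex_on UNIV (\<lambda>(w :: real ^ 'n ^ 'm, c :: real ^ 'n). g_fun \<sigma> b w c v)"
  unfolding g_fun_def case_prod_unfold
  by (intro convex_on_ln_sum_exp finite_hidden_states hidden_states_nonempty convex_on_neg_energy) simp

lemma LINT_exp_energy_pos:
  fixes \<sigma> b :: "real ^ 'm" and w :: "real ^ 'n ^ 'm" and c h :: "real ^ 'n"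
  assumes "\<And>i. \<sigma> $ i \<noteq> 0"
  shows "0 < (LINT v|lborel. exp (- energy \<sigma> b v h w c))"
  by (intro integral_exp_pos integrable_exp_energy assms) simp

lemma convex_on_f_fun:
  fixes \<sigma> b :: "real ^ 'm"
  assumes "\<And>i. \<sigma> $ i \<noteq> 0"
  shows "convex_on UNIV (\<lambda>(w :: real ^ 'n ^ 'm, c :: real ^ 'n). f_fun \<sigma> b w c)"
proof -
  define \<phi> where "\<phi> p h = ln (LINT v|lborel. exp (- energy \<sigma> b v h (fst p) (snd p)))"
    for p :: "(real ^ 'n ^ 'm) \<times> (real ^ 'n)" and h
  have "convex_on UNIV (\<lambda>p. \<phi> p h)" for h
    unfolding \<phi>_def
    by (intro convex_on_ln_integral_exp convex_on_neg_energy integrable_exp_energy assms) simp_all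
  \<comment> \<open>Log-sum-exp is applied a second time, now to the logarithms of the integrals. As
    the integrals are positive, \<open>exp\<close> undoes these logarithms and the sum is the one in
    \<open>f_fun\<close>.\<close>
  then have "convex_on UNIV (\<lambda>p. ln (\<Sum>h\<in>hidden_states. exp (\<phi> p h)))"
    by (intro convex_on_ln_sum_exp finite_hidden_states hidden_states_nonempty) simp_all
  then show ?thesis
    by (simp add: f_fun_def \<phi>_def case_prod_unfold LINT_exp_energy_pos[OF assms])
qed

text \<open>The partition function is the same for all \<open>h\<close>, so it factors out of the
  marginal sum; positivity of both parts lets \<open>ln\<close> split the quotient.\<close>

lemma log_likelihood_eq_diff:
  fixes \<sigma> b :: "real ^ 'm" and w :: "real ^ 'n ^ 'm" and c :: "real ^ 'n"
  assumes "\<And>i. \<sigma> $ i \<noteq> 0"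
  shows "log_likelihood \<sigma> b w c v = g_fun \<sigma> b w c v - f_fun \<sigma> b w c"
proof -
  have "0 < (\<Sum>h\<in>hidden_states. exp (- energy \<sigma> b v h w c))"
    by (intro sum_pos finite_hidden_states hidden_states_nonempty) simp
  moreover have "0 < partition_function \<sigma> b w c"
    unfolding partition_function_def
    by (intro sum_pos finite_hidden_states hidden_states_nonempty LINT_exp_energy_pos assms)
  ultimately show ?thesis
    by (simp add: log_likelihood_def marginal_density_def joint_density_def g_fun_def f_fun_def
        ln_div partition_function_def flip: sum_divide_distrib)
qed

text \<open>The integrability claim ensures that the integrals in \<open>f_fun\<close> are genuine,
  since the integral of a non-integrable function is 0 by convention.\<close>

theorem mainTheorem1:
  fixes \<sigma> b :: "real ^ 'm"
  assumes "\<And>i. 0 < (\<sigma> $ i)\<^sup>2"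
  shows "(\<forall>(w :: real ^ 'n ^ 'm) (c :: real ^ 'n). \<forall>h\<in>hidden_states.
            integrable lborel (\<lambda>v. exp (- energy \<sigma> b v h w c)))
       \<and> convex_on UNIV (\<lambda>(w :: real ^ 'n ^ 'm, c :: real ^ 'n). f_fun \<sigma> b w c)
       \<and> (\<forall>v. convex_on UNIV (\<lambda>(w :: real ^ 'n ^ 'm, c :: real ^ 'n). g_fun \<sigma> b w c v)
            \<and> (\<forall>(w :: real ^ 'n ^ 'm) (c :: real ^ 'n).
                  log_likelihood \<sigma> b w c v = g_fun \<sigma> b w c v - f_fun \<sigma> b w c)
            \<and> difference_of_convex
                 (\<lambda>(w :: real ^ 'n ^ 'm, c :: real ^ 'n). log_likelihood \<sigma> b w c v))"
proof -
  have \<sigma>: "\<sigma> $ i \<noteq> 0" for i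
    using assms[of i] by simp
  have "difference_of_convex (\<lambda>(w :: real ^ 'n ^ 'm, c :: real ^ 'n). log_likelihood \<sigma> b w c v)" for v
    unfolding difference_of_convex_def
  proof (intro exI conjI)
    show "convex_on UNIV (\<lambda>(w :: real ^ 'n ^ 'm, c :: real ^ 'n). g_fun \<sigma> b w c v)"
      by (rule convex_on_g_fun)
    show "convex_on UNIV (\<lambda>(w :: real ^ 'n ^ 'm, c :: real ^ 'n). f_fun \<sigma> b w c)"
      using \<sigma> by (rule convex_on_f_fun)
  qed (auto simp: log_likelihood_eq_diff[OF \<sigma>])
  then show ?thesis
    using integrable_exp_energy[OF \<sigma>] convex_on_f_fun[OF \<sigma>] convex_on_g_fun log_likelihood_eq_diff[OF \<sigma>]
    by blast
qed

end
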